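(* Let $n\ge1$. The graded $S_n$-representation $H^*((S^1)^n,\mathbb{R})=\Lambda_{\mathbb{R}}[\alpha_1,\dots,\alpha_n]$ is strongly equivariantly log-concave: writing $V^i$ for its degree-$i$ piece (which vanishes except for $0\le i\le n$), for any $0\le m\le 2n$ there are inclusions of $S_n$-representations $$V^0\otimes V^m\subset V^1\otimes V^{m-1}\subset V^2\otimes V^{m-2}\subset\cdots\subset\begin{cases}V^{m/2}\otimes V^{m/2}&\text{if } m \text{ is even},\\ V^{(m-1)/2}\otimes V^{(m+1)/2}&\text{if } m\text{ is odd}.\end{cases}$$ Furthermore, the inclusions $V^{i-1}\otimes V^{m-i+1}\to V^{i}\otimes V^{m-i}$ ($1\le i\le\lfloor m/2\rfloor$) of $S_n$-representations are given by the operator $L=\sum_{k=1}^n e_{\alpha_k}\otimes i_{\alpha_k^*}$.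
   Context: $\Lambda_{\mathbb{R}}[\alpha_1,\dots,\alpha_n]$ is the exterior algebra of the real vector space $V=\langle\alpha_1,\dots,\alpha_n\rangle$ with each $\alpha_k$ of degree $1$. $S_n$ acts on the torus $(S^1)^n$ by permuting the factors; the induced action on the exterior algebra is by permuting the indices of the $\alpha_k$. The symbol $\subset$ between representations means that there is an injective $S_n$-equivariant linear map. Here $(e_{\alpha_k}\otimes i_{\alpha_k^*})(u\otimes w)=(\alpha_k\wedge u)\otimes i_{\alpha_k^*}(w)$ (no extra sign), $\alpha_k^*$ is the linear functional on $V$ with $\alpha_k^*(\alpha_l)=\delta_{kl}$, and $i_{\beta}$ for $\beta\in V^*$ is the interior product on the exterior algebra: the degree $-1$ anti-derivation with $i_\beta(v)=\beta(v)$ for $v\in V$, $i_\beta(u\wedge v)=(i_\beta u)\wedge v+(-1)^{\deg u}u\wedge i_\beta v$, and $i_\beta=0$ on scalars. *)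

theory Defs
  imports "HOL-Analysis.Analysis"
begin

section \<open>The exterior algebra of \<open>\<real>\<^sup>n\<close>\<close>

text \<open>
  The generators are indexed by a finite linearly ordered type \<open>'n\<close> (so \<open>n = CARD('n) \<ge> 1\<close>). The
  exterior algebra of \<open>real ^ 'n\<close> is modelled on \<open>real ^ ('n set)\<close>: the standard basis vector at
  \<open>S = {k\<^sub>1 < \<dots> < k\<^sub>p}\<close> stands for \<open>\<alpha>\<^bsub>k\<^sub>1\<^esub> \<and> \<dots> \<and> \<alpha>\<^bsub>k\<^sub>p\<^esub>\<close>. The order only fixes these signs. That this is
  the exterior algebra is the content of \<open>exterior_universal_property\<close> below.
\<close>

definition ext_basis :: "'n::{finite,linorder} set \<Rightarrow> real ^ ('n set)" where
  "ext_basis S = axis S 1"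

definition inversions :: "'n::linorder set \<Rightarrow> 'n set \<Rightarrow> nat" where
  "inversions A B = card {(a, b). a \<in> A \<and> b \<in> B \<and> b < a}"

definition wedge_basis :: "'n::{finite,linorder} set \<Rightarrow> 'n set \<Rightarrow> real ^ ('n set)" where
  "wedge_basis A B =
     (if A \<inter> B = {} then (- 1) ^ inversions A B *\<^sub>R ext_basis (A \<union> B) else 0)"

definition wedge ::
  "real ^ ('n::{finite,linorder} set) \<Rightarrow> real ^ ('n set) \<Rightarrow> real ^ ('n set)" (infixr "\<^bold>\<and>" 75) where
  "u \<^bold>\<and> w = (\<Sum>A\<in>UNIV. \<Sum>B\<in>UNIV. (u $ A * w $ B) *\<^sub>R wedge_basis A B)"

definition ext_one :: "real ^ ('n::{finite,linorder} set)" where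
  "ext_one = ext_basis {}"

definition ext_vec :: "real ^ 'n::{finite,linorder} \<Rightarrow> real ^ ('n set)" where
  "ext_vec v = (\<Sum>k\<in>UNIV. v $ k *\<^sub>R ext_basis {k})"

definition ext_gen :: "'n \<Rightarrow> real ^ ('n::{finite,linorder} set)" where
  "ext_gen k = ext_vec (axis k 1)"

definition ext_grade :: "nat \<Rightarrow> (real ^ ('n::{finite,linorder} set)) set" where
  "ext_grade p = span {ext_basis S | S. card S = p}"


subsection \<open>Sanity checks for the model\<close>

lemma linear_eq_axis:
  fixes f g :: "real ^ 'a \<Rightarrow> 'b::real_vector"
  assumes "linear f" "linear g" "\<And>i. f (axis i 1) = g (axis i 1)"
  shows "f = g"
proof
  fix x :: "real ^ 'a"
  have x: "x = (\<Sum>i\<in>UNIV. x $ i *\<^sub>R axis i 1)"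
    using basis_expansion[of x] by (simp add: scalar_mult_eq_scaleR)
  have "f x = (\<Sum>i\<in>UNIV. x $ i *\<^sub>R f (axis i 1))"
    by (subst x) (simp add: linear_sum[OF assms(1)] linear_scale[OF assms(1)])
  also have "\<dots> = g x"
    by (subst (2) x) (simp add: linear_sum[OF assms(2)] linear_scale[OF assms(2)] assms(3))
  finally show "f x = g x" .
qed

lemma linear_eq_ext_basis:
  fixes f g :: "real ^ ('n::{finite,linorder} set) \<Rightarrow> 'b::real_vector"
  assumes "linear f" "linear g" "\<And>S. f (ext_basis S) = g (ext_basis S)"
  shows "f = g"
  by (rule linear_eq_axis) (use assms in \<open>auto simp: ext_basis_def\<close>)

lemma linear_coeff_sum:
  fixes h :: "'a::finite \<Rightarrow> 'b::real_vector"
  shows "linear (\<lambda>x::real ^ 'a. \<Sum>i\<in>UNIV. x $ i *\<^sub>R h i)"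
  by (rule linearI) (auto simp: scaleR_left_distrib sum.distrib scaleR_sum_right)

lemma coeff_sum_axis:
  fixes h :: "'a::finite \<Rightarrow> 'b::real_vector"
  shows "(\<Sum>i\<in>UNIV. axis k 1 $ i *\<^sub>R h i) = h k"
proof -
  have "(\<Sum>i\<in>UNIV. axis k (1::real) $ i *\<^sub>R h i) = (\<Sum>i\<in>UNIV. if i = k then h i else 0)"
    by (rule sum.cong) (auto simp: axis_def)
  then show ?thesis by simp
qed

lemma linear_ext_vec: "linear ext_vec"
  unfolding ext_vec_def by (rule linear_coeff_sum)

lemma ext_gen_eq: "ext_gen k = ext_basis {k}"
  unfolding ext_gen_def ext_vec_def by (rule coeff_sum_axis)

lemma wedge_left: "u \<^bold>\<and> w = (\<Sum>A\<in>UNIV. u $ A *\<^sub>R (\<Sum>B\<in>UNIV. w $ B *\<^sub>R wedge_basis A B))"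
  by (simp add: wedge_def scaleR_sum_right)

lemma wedge_right: "u \<^bold>\<and> w = (\<Sum>B\<in>UNIV. w $ B *\<^sub>R (\<Sum>A\<in>UNIV. u $ A *\<^sub>R wedge_basis A B))"
  unfolding wedge_def by (subst sum.swap) (simp add: scaleR_sum_right mult.commute)

lemma bilinear_wedge: "bilinear (\<^bold>\<and>)"
  unfolding bilinear_def
proof (intro conjI allI)
  show "linear (\<lambda>w. u \<^bold>\<and> w)" for u :: "real ^ ('a set)"
    unfolding wedge_right by (rule linear_coeff_sum)
  show "linear (\<lambda>u. u \<^bold>\<and> w)" for w :: "real ^ ('a set)"
    unfolding wedge_left by (rule linear_coeff_sum)
qed

lemma wedge_ext_basis: "ext_basis A \<^bold>\<and> ext_basis B = wedge_basis A B"
  unfolding wedge_left ext_basis_def by (simp add: coeff_sum_axis)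

lemma linear_wedge_left: "linear (\<lambda>u. u \<^bold>\<and> w)"
  and linear_wedge_right: "linear (\<lambda>w. u \<^bold>\<and> w)"
  using bilinear_wedge by (auto simp: bilinear_def)

lemma inversions_Un_left:
  fixes A :: "'n::{finite,linorder} set"
  assumes "A \<inter> A' = {}"
  shows "inversions (A \<union> A') B = inversions A B + inversions A' B"
proof -
  have "{(a, b). a \<in> A \<union> A' \<and> b \<in> B \<and> b < a}
      = {(a, b). a \<in> A \<and> b \<in> B \<and> b < a} \<union> {(a, b). a \<in> A' \<and> b \<in> B \<and> b < a}" by auto
  then show ?thesis unfolding inversions_def using assms by (subst card_Un_disjoint[symmetric]) auto
qed

lemma inversions_Un_right:
  fixes A :: "'n::{finite,linorder} set"
  assumes "B \<inter> B' = {}"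
  shows "inversions A (B \<union> B') = inversions A B + inversions A B'"
proof -
  have "{(a, b). a \<in> A \<and> b \<in> B \<union> B' \<and> b < a}
      = {(a, b). a \<in> A \<and> b \<in> B \<and> b < a} \<union> {(a, b). a \<in> A \<and> b \<in> B' \<and> b < a}" by auto
  then show ?thesis unfolding inversions_def using assms by (subst card_Un_disjoint[symmetric]) auto
qed

lemma inversions_empty [simp]: "inversions {} B = 0" "inversions A {} = 0"
  by (auto simp: inversions_def)

lemma inversions_singleton_insert:
  fixes A :: "'n::{finite,linorder} set"
  assumes "b \<notin> A"
  shows "inversions {k} (insert b A) = (if b < k then 1 else 0) + inversions {k} A"
proof -
  have "{(a, c). a = k \<and> c = b \<and> c < a} = (if b < k then {(k, b)} else {})" by auto
  then have "inversions {k} {b} = (if b < k then 1 else 0)" by (simp add: inversions_def)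
  then show ?thesis using inversions_Un_right[of "{b}" A "{k}"] assms by simp
qed

lemma inversions_singleton_less:
  assumes "\<And>a. a \<in> A \<Longrightarrow> b < a"
  shows "inversions {b} A = 0"
proof -
  have "{(a, c). a \<in> {b} \<and> c \<in> A \<and> c < a} = {}" using assms by force
  then show ?thesis unfolding inversions_def by (simp only: card.empty)
qed

lemma inversions_swap:
  fixes A :: "'n::{finite,linorder} set"
  assumes "k \<notin> A"
  shows "inversions {k} A + inversions A {k} = card A"
proof -
  have "{(a, b). a = k \<and> b \<in> A \<and> b < a} = (\<lambda>b. (k, b)) ` {b\<in>A. b < k}" by auto
  moreover have "{(a, b). a \<in> A \<and> b = k \<and> b < a} = (\<lambda>a. (a, k)) ` {b\<in>A. k < b}" by auto
  moreover have "A = {b\<in>A. b < k} \<union> {b\<in>A. k < b}"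
    using assms by (auto, metis linorder_neqE)
  moreover have "card ({b\<in>A. b < k} \<union> {b\<in>A. k < b}) = card {b\<in>A. b < k} + card {b\<in>A. k < b}"
    by (rule card_Un_disjoint) auto
  ultimately show ?thesis
    by (simp add: inversions_def card_image inj_on_def)
qed

lemma wedge_ext_one [simp]: "ext_one \<^bold>\<and> u = u" "u \<^bold>\<and> ext_one = u"
proof -
  have "(\<lambda>u::real^('n::{finite,linorder} set). ext_one \<^bold>\<and> u) = (\<lambda>u. u)"
    by (rule linear_eq_ext_basis[OF linear_wedge_right linear_ident])
       (simp add: ext_one_def wedge_ext_basis wedge_basis_def)
  then show "ext_one \<^bold>\<and> u = u" for u :: "real^('n::{finite,linorder} set)" by metis
  have "(\<lambda>u::real^('n::{finite,linorder} set). u \<^bold>\<and> ext_one) = (\<lambda>u. u)"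
    by (rule linear_eq_ext_basis[OF linear_wedge_left linear_ident])
       (simp add: ext_one_def wedge_ext_basis wedge_basis_def)
  then show "u \<^bold>\<and> ext_one = u" for u :: "real^('n::{finite,linorder} set)" by metis
qed

lemma wedge_assoc_basis:
  "(ext_basis A \<^bold>\<and> ext_basis B) \<^bold>\<and> ext_basis C = ext_basis A \<^bold>\<and> (ext_basis B \<^bold>\<and> ext_basis C)"
proof (cases "A \<inter> B = {} \<and> A \<inter> C = {} \<and> B \<inter> C = {}")
  case True
  then have "(A \<union> B) \<inter> C = {}" "A \<inter> (B \<union> C) = {}" by auto
  with True show ?thesis
    by (simp add: wedge_ext_basis wedge_basis_def linear_scale[OF linear_wedge_left]
        linear_scale[OF linear_wedge_right] inversions_Un_left inversions_Un_right
        power_add Un_assoc)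
next
  case False
  then have "A \<inter> B \<noteq> {} \<or> (A \<union> B) \<inter> C \<noteq> {}" "B \<inter> C \<noteq> {} \<or> A \<inter> (B \<union> C) \<noteq> {}" by auto
  then show ?thesis
    by (auto simp: wedge_ext_basis wedge_basis_def linear_scale[OF linear_wedge_left]
        linear_scale[OF linear_wedge_right] linear_0[OF linear_wedge_left]
        linear_0[OF linear_wedge_right])
qed

lemma wedge_assoc: "(u \<^bold>\<and> v) \<^bold>\<and> w = u \<^bold>\<and> (v \<^bold>\<and> w)"
proof -
  note lin = linear_compose[OF _ linear_wedge_left, unfolded o_def]
             linear_compose[OF _ linear_wedge_right, unfolded o_def]
             linear_wedge_left linear_wedge_right
  have 1: "(\<lambda>w. (ext_basis A \<^bold>\<and> ext_basis B) \<^bold>\<and> w) = (\<lambda>w. ext_basis A \<^bold>\<and> (ext_basis B \<^bold>\<and> w))"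
    for A B :: "'a set"
    by (rule linear_eq_ext_basis) (intro lin wedge_assoc_basis)+
  have 2: "(\<lambda>v. (ext_basis A \<^bold>\<and> v) \<^bold>\<and> w) = (\<lambda>v. ext_basis A \<^bold>\<and> (v \<^bold>\<and> w))" for A
    by (rule linear_eq_ext_basis) (intro lin fun_cong[OF 1])+
  have 3: "(\<lambda>u. (u \<^bold>\<and> v) \<^bold>\<and> w) = (\<lambda>u. u \<^bold>\<and> (v \<^bold>\<and> w))"
    by (rule linear_eq_ext_basis) (intro lin fun_cong[OF 2])+
  then show ?thesis by metis
qed

lemma ext_basis_insert:
  assumes "\<And>a. a \<in> A \<Longrightarrow> b < a"
  shows "ext_basis (insert b A) = ext_gen b \<^bold>\<and> ext_basis A"
  using assms inversions_singleton_less[of A b]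
  by (auto simp: ext_gen_eq wedge_ext_basis wedge_basis_def)

lemma ext_basis_eq_wedge_list:
  "ext_basis S = foldr (\<lambda>k u. ext_gen k \<^bold>\<and> u) (sorted_list_of_set S) ext_one"
proof -
  have "finite S" by simp
  then show ?thesis
  proof (induction S rule: finite_linorder_min_induct)
    case empty
    then show ?case by (simp add: ext_one_def)
  next
    case (insert b A)
    then have "sorted_list_of_set (insert b A) = b # sorted_list_of_set A"
      using insort_is_Cons[of "sorted_list_of_set A" "\<lambda>x. x" b]
      by (auto simp: sorted_list_of_set_insert less_imp_le)
    then show ?case using insert by (simp add: ext_basis_insert)
  qed
qed

lemma linear_square_zero_anticommute:
  fixes f :: "'a::real_vector \<Rightarrow> 'b::real_vector"
  assumes "bilinear m" "linear f" "\<And>v. m (f v) (f v) = 0"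
  shows "m (f v) (f w) = - m (f w) (f v)"
  using assms(3)[of "v + w"]
  by (simp add: linear_add[OF assms(2)] bilinear_ladd[OF assms(1)] bilinear_radd[OF assms(1)]
      assms(3) eq_neg_iff_add_eq_0 add.commute)

lemma wedge_gen_anticommute: "ext_gen k \<^bold>\<and> ext_gen l = - (ext_gen l \<^bold>\<and> ext_gen k)"
proof (cases "k = l")
  case True
  then show ?thesis by (simp add: ext_gen_eq wedge_ext_basis wedge_basis_def)
next
  case False
  have "inversions {k} {l} + inversions {l} {k} = 1"
    using inversions_swap[of k "{l}"] False by simp
  then have "(inversions {k} {l} = 0 \<and> inversions {l} {k} = 1) \<or>
             (inversions {k} {l} = 1 \<and> inversions {l} {k} = 0)" by linarith
  then show ?thesis using False
    by (auto simp: ext_gen_eq wedge_ext_basis wedge_basis_def insert_commute)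
qed

lemma ext_vec_square: "ext_vec v \<^bold>\<and> ext_vec v = 0"
proof -
  have e: "ext_vec v = (\<Sum>k\<in>UNIV. v $ k *\<^sub>R ext_gen k)"
    by (simp add: ext_vec_def ext_gen_eq)
  define X where "X = (\<Sum>k\<in>UNIV. \<Sum>l\<in>UNIV. (v $ k * v $ l) *\<^sub>R (ext_gen k \<^bold>\<and> ext_gen l))"
  have "ext_vec v \<^bold>\<and> ext_vec v = X"
    unfolding e X_def
    by (simp add: linear_sum[OF linear_wedge_left] linear_sum[OF linear_wedge_right]
        linear_scale[OF linear_wedge_left] linear_scale[OF linear_wedge_right] scaleR_sum_right)
       (subst sum.swap, simp add: mult.commute)
  moreover have "X = - X"
  proof -
    have "X = (\<Sum>l\<in>UNIV. \<Sum>k\<in>UNIV. (v $ k * v $ l) *\<^sub>R (ext_gen k \<^bold>\<and> ext_gen l))"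
      unfolding X_def by (rule sum.swap)
    also have "\<dots> = (\<Sum>l\<in>UNIV. \<Sum>k\<in>UNIV. - ((v $ l * v $ k) *\<^sub>R (ext_gen l \<^bold>\<and> ext_gen k)))"
      by (intro sum.cong refl, subst wedge_gen_anticommute) (simp add: mult.commute)
    also have "\<dots> = - X" by (simp add: X_def sum_negf)
    finally show ?thesis .
  qed
  ultimately show ?thesis by (simp add: eq_neg_iff_add_eq_0 flip: scaleR_2)
qed

definition is_exterior_extension ::
  "('b::real_vector \<Rightarrow> 'b \<Rightarrow> 'b) \<Rightarrow> 'b \<Rightarrow> (real ^ 'n::{finite,linorder} \<Rightarrow> 'b)
    \<Rightarrow> (real ^ ('n set) \<Rightarrow> 'b) \<Rightarrow> bool" where
  "is_exterior_extension m e f g \<longleftrightarrow>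
     linear g \<and> g ext_one = e \<and> (\<forall>u w. g (u \<^bold>\<and> w) = m (g u) (g w)) \<and> (\<forall>v. g (ext_vec v) = f v)"

theorem exterior_universal_property:
  fixes m :: "'b::real_vector \<Rightarrow> 'b \<Rightarrow> 'b" and f :: "real ^ 'n::{finite,linorder} \<Rightarrow> 'b"
  assumes m: "bilinear m" and assoc: "\<And>a b c. m (m a b) c = m a (m b c)"
    and unit: "\<And>a. m e a = a" "\<And>a. m a e = a"
    and f: "linear f" and sq: "\<And>v. m (f v) (f v) = 0"
  shows "\<exists>!g. is_exterior_extension m e f g"
proof (rule ex_ex1I)
  define F where "F k = f (axis k 1)" for k
  define G where "G S = foldr (\<lambda>k u. m (F k) u) (sorted_list_of_set S) e" for S
  define g where "g x = (\<Sum>S\<in>UNIV. x $ S *\<^sub>R G S)" for x :: "real ^ ('n set)"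
  have G0: "G {} = e" by (simp add: G_def)
  have G_insert: "G (insert b A) = m (F b) (G A)" if "\<And>a. a \<in> A \<Longrightarrow> b < a" for b A
  proof -
    have "b \<notin> A" using that by force
    then have "sorted_list_of_set (insert b A) = b # sorted_list_of_set A"
      using insort_is_Cons[of "sorted_list_of_set A" "\<lambda>x. x" b] that
      by (auto simp: sorted_list_of_set_insert less_imp_le)
    then show ?thesis by (simp add: G_def)
  qed
  have anti: "m (F k) (F l) = - m (F l) (F k)" for k l
    unfolding F_def by (rule linear_square_zero_anticommute[OF m f sq])
  have FG: "m (F k) (G A) =
      (if k \<in> A then 0 else (- 1) ^ inversions {k} A *\<^sub>R G (insert k A))" for k A
  proof -
    have "finite A" by simp
    then show ?thesis
    proof (induction A rule: finite_linorder_min_induct)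
      case empty
      then show ?case using G_insert[of "{}" k] by simp
    next
      case (insert b A)
      then have bA: "\<And>a. a \<in> A \<Longrightarrow> b < a" and bnA: "b \<notin> A" by auto
      consider "k < b" | "k = b" | "b < k" by (rule linorder_cases)
      then show ?case
      proof cases
        case 1
        then have lt: "\<And>a. a \<in> insert b A \<Longrightarrow> k < a" using bA by force
        then have "k \<notin> insert b A" by blast
        then show ?thesis using lt inversions_singleton_less[of "insert b A" k] G_insert[of "insert b A" k]
          by simp
      next
        case 2
        have "m (F k) (G (insert b A)) = m (m (F k) (F b)) (G A)"
          by (simp add: G_insert[OF bA] assoc)
        then show ?thesis using 2 sq by (simp add: F_def bilinear_lzero[OF m])
      next
        case 3
        have "m (F k) (G (insert b A)) = - m (F b) (m (F k) (G A))"
          by (simp add: G_insert[OF bA] assoc[symmetric] anti[of k b] bilinear_lneg[OF m])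
        also have "\<dots> = (if k \<in> A then 0
            else - ((- 1) ^ inversions {k} A *\<^sub>R m (F b) (G (insert k A))))"
          by (simp add: insert.IH bilinear_rmul[OF m] bilinear_rzero[OF m])
        also have "m (F b) (G (insert k A)) = G (insert k (insert b A))"
          using G_insert[of "insert k A" b, symmetric] bA 3
          by (subst insert_commute[of k b A]) blast
        finally show ?thesis
          using 3 bnA by (auto simp: inversions_singleton_insert)
      qed
    qed
  qed
  have GG: "m (G A) (G B) = (if A \<inter> B = {} then (- 1) ^ inversions A B *\<^sub>R G (A \<union> B) else 0)" for A B
  proof -
    have "finite A" by simp
    then show ?thesis
    proof (induction A rule: finite_linorder_min_induct)
      case empty
      then show ?case by (simp add: G0 unit)
    next
      case (insert b A)
      then have bA: "\<And>a. a \<in> A \<Longrightarrow> b < a" and bnA: "b \<notin> A" by auto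
      have inv: "inversions {b} (A \<union> B) = inversions {b} B" if "A \<inter> B = {}"
        using inversions_Un_right[OF that, of "{b}"] inversions_singleton_less[OF bA] by simp
      have inv2: "inversions (insert b A) B = inversions {b} B + inversions A B"
        using inversions_Un_left[of "{b}" A B] bnA by simp
      have "m (G (insert b A)) (G B) = m (F b) (m (G A) (G B))"
        by (simp add: G_insert[OF bA] assoc)
      then show ?case using insert.IH bnA inv
        by (auto simp: bilinear_rmul[OF m] bilinear_rzero[OF m] FG inv2 power_add mult.commute)
    qed
  qed
  have lin_g: "linear g" unfolding g_def by (rule linear_coeff_sum)
  have g_basis: "g (ext_basis S) = G S" for S
    unfolding g_def ext_basis_def by (rule coeff_sum_axis)
  have "g (u \<^bold>\<and> w) = m (g u) (g w)" for u w
  proof -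
    have lm: "linear (\<lambda>y. m x y)" "linear (\<lambda>x. m x y)" for x y
      using m by (auto simp: bilinear_def)
    have 1: "(\<lambda>w. g (ext_basis A \<^bold>\<and> w)) = (\<lambda>w. m (g (ext_basis A)) (g w))" for A
      by (rule linear_eq_ext_basis)
         (auto intro: linear_compose[OF linear_wedge_right lin_g, unfolded o_def]
            linear_compose[OF lin_g lm(1), unfolded o_def]
            simp: wedge_ext_basis wedge_basis_def g_basis GG linear_scale[OF lin_g] linear_0[OF lin_g])
    have 2: "(\<lambda>u. g (u \<^bold>\<and> w)) = (\<lambda>u. m (g u) (g w))"
      by (rule linear_eq_ext_basis)
         (auto intro: linear_compose[OF linear_wedge_left lin_g, unfolded o_def]
            linear_compose[OF lin_g lm(2), unfolded o_def] fun_cong[OF 1])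
    then show ?thesis by metis
  qed
  moreover have "g (ext_vec v) = f v" for v
  proof -
    have "(\<lambda>v. g (ext_vec v)) = f"
    proof (rule linear_eq_axis)
      show "linear (\<lambda>v. g (ext_vec v))"
        using linear_compose[OF linear_ext_vec lin_g] by (simp add: o_def)
      show "g (ext_vec (axis k 1)) = f (axis k 1)" for k
        using G_insert[of "{}" k]
        by (simp add: ext_gen_eq g_basis G0 unit F_def flip: ext_gen_def)
    qed (rule f)
    then show ?thesis by metis
  qed
  ultimately show "\<exists>g. is_exterior_extension m e f g"
    unfolding is_exterior_extension_def
    using lin_g g_basis[of "{}"] G0 by (auto simp: ext_one_def)
next
  fix g h
  assume gh: "is_exterior_extension m e f g" "is_exterior_extension m e f h"
  show "g = h"
  proof (rule linear_eq_ext_basis)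
    show "g (ext_basis S) = h (ext_basis S)" for S
    proof -
      have "finite S" by simp
      then show ?thesis
      proof (induction S rule: finite_linorder_min_induct)
        case empty
        then show ?case using gh by (simp add: is_exterior_extension_def ext_one_def)
      next
        case (insert b A)
        then have "ext_basis (insert b A) = ext_vec (axis b 1) \<^bold>\<and> ext_basis A"
          using ext_basis_insert[of A b] by (auto simp: ext_gen_def)
        then show ?case using gh insert.IH by (simp add: is_exterior_extension_def)
      qed
    qed
  qed (use gh in \<open>auto simp: is_exterior_extension_def\<close>)
qed

lemma ext_basis_in_grade: "card S = p \<Longrightarrow> ext_basis S \<in> ext_grade p"
  unfolding ext_grade_def by (auto intro: span_base)

lemma ext_vec_in_grade: "ext_vec v \<in> ext_grade 1"
  unfolding ext_vec_def ext_grade_def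
  by (intro span_sum span_scale span_base) auto

lemma ext_grade_eq_0:
  assumes "p > CARD('n::{finite,linorder})"
  shows "(ext_grade p :: (real ^ ('n set)) set) = {0}"
proof -
  have "card S \<le> CARD('n)" for S :: "'n set" by (intro card_mono) auto
  then have "card S \<noteq> p" for S :: "'n set" using assms by (metis linorder_not_le)
  then have e: "{ext_basis S | S :: 'n set. card S = p} = {}" by simp
  show ?thesis unfolding ext_grade_def e by simp
qed


section \<open>The interior product\<close>

definition is_interior_product ::
  "(real ^ 'n::{finite,linorder} \<Rightarrow> real) \<Rightarrow> (real ^ ('n set) \<Rightarrow> real ^ ('n set)) \<Rightarrow> bool" where
  "is_interior_product \<beta> d \<longleftrightarrow>
     linear d \<and>
     d ext_one = 0 \<and>
     (\<forall>p. d ` ext_grade (Suc p) \<subseteq> ext_grade p) \<and>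
     (\<forall>v. d (ext_vec v) = \<beta> v *\<^sub>R ext_one) \<and>
     (\<forall>p. \<forall>u\<in>ext_grade p. \<forall>w. d (u \<^bold>\<and> w) = d u \<^bold>\<and> w + (- 1) ^ p *\<^sub>R (u \<^bold>\<and> d w))"

definition interior_product ::
  "(real ^ 'n::{finite,linorder} \<Rightarrow> real) \<Rightarrow> real ^ ('n set) \<Rightarrow> real ^ ('n set)" where
  "interior_product \<beta> = (THE d. is_interior_product \<beta> d)"

definition contract_basis :: "'n \<Rightarrow> 'n::{finite,linorder} set \<Rightarrow> real ^ ('n set)" where
  "contract_basis k S =
     (if k \<in> S then (- 1) ^ inversions {k} S *\<^sub>R ext_basis (S - {k}) else 0)"

lemma inversions_singleton_remove:
  fixes S :: "'n::{finite,linorder} set"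
  shows "inversions {k} (S - {k}) = inversions {k} S"
proof -
  have "{(a, b). a = k \<and> b \<in> S \<and> b \<noteq> k \<and> b < a} = {(a, b). a = k \<and> b \<in> S \<and> b < a}" by auto
  then show ?thesis by (simp add: inversions_def)
qed

lemma contract_basis_antiderivation:
  fixes A B :: "'n::{finite,linorder} set" and k :: 'n
  defines "D \<equiv> \<lambda>x. \<Sum>S\<in>UNIV. x $ S *\<^sub>R contract_basis k S"
  shows "D (ext_basis A \<^bold>\<and> ext_basis B) =
    D (ext_basis A) \<^bold>\<and> ext_basis B + (- 1) ^ card A *\<^sub>R (ext_basis A \<^bold>\<and> D (ext_basis B))"
proof -
  have lin: "linear D" unfolding D_def by (rule linear_coeff_sum)
  have D: "D (ext_basis S) = contract_basis k S" for S
    unfolding D_def ext_basis_def by (rule coeff_sum_axis)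
  define A' where "A' = A - {k}"
  define B' where "B' = B - {k}"
  have k': "k \<notin> A'" "k \<notin> B'" by (auto simp: A'_def B'_def)
  define a where "a = inversions {k} A'"
  define b where "b = inversions {k} B'"
  have kA: "inversions {k} A = a" and kB: "inversions {k} B = b"
    by (simp_all add: a_def b_def A'_def B'_def inversions_singleton_remove)
  have par: "inversions A' {k} = card A' - a" "a \<le> card A'"
    using inversions_swap[OF k'(1)] by (auto simp: a_def)
  have s: "(- 1 :: real) ^ (card A' - a) = (- 1) ^ card A' * (- 1) ^ a"
    using par(2) by (simp add: power_diff divide_inverse flip: power_inverse)
  note simps = wedge_ext_basis wedge_basis_def contract_basis_def D
    linear_scale[OF lin] linear_0[OF lin] linear_scale[OF linear_wedge_left]
    linear_scale[OF linear_wedge_right] linear_0[OF linear_wedge_left] linear_0[OF linear_wedge_right]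
  have sq: "(- 1 :: real) ^ j * ((- 1) ^ j * x) = x" for j x
    by (simp add: mult.assoc[symmetric] power_mult_distrib[symmetric])
  consider "k \<notin> A" "k \<notin> B" | "k \<in> A" "k \<notin> B" | "k \<notin> A" "k \<in> B" | "k \<in> A" "k \<in> B" by blast
  then show ?thesis
  proof cases
    case 1
    then show ?thesis by (simp add: simps)
  next
    case 2
    then have B: "B' = B" and A: "A = insert k A'" by (auto simp: A'_def B'_def)
    show ?thesis
    proof (cases "A' \<inter> B = {}")
      case True
      have "A \<inter> B = {}" using True 2 A by auto
      moreover have "inversions A B = b + inversions A' B"
        using inversions_Un_left[of "{k}" A' B] k' A kB by simp
      moreover have "inversions {k} (A \<union> B) = a + b"
        using inversions_Un_right[OF \<open>A \<inter> B = {}\<close>, of "{k}"] kA kB by simp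
      moreover have "A \<union> B - {k} = A' \<union> B" using 2 by (auto simp: A'_def)
      ultimately show ?thesis using 2 True kA
        by (simp add: simps power_add sq mult.assoc mult.left_commute flip: A'_def)
    next
      case False
      then have "A \<inter> B \<noteq> {}" using A by auto
      then show ?thesis using 2 False by (simp add: simps flip: A'_def)
    qed
  next
    case 3
    then have A: "A' = A" and B: "B = insert k B'" by (auto simp: A'_def B'_def)
    show ?thesis
    proof (cases "A \<inter> B' = {}")
      case True
      have dis: "A \<inter> B = {}" using True 3 B by auto
      moreover have "inversions A B = (card A - a) + inversions A B'"
        using inversions_Un_right[of "{k}" B' A] k' B par A by simp
      moreover have "inversions {k} (A \<union> B) = a + b"
        using inversions_Un_right[OF dis, of "{k}"] kA kB by simp
      moreover have "A \<union> B - {k} = A \<union> B'" using 3 by (auto simp: B'_def)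
      ultimately show ?thesis using 3 True kB s A
        by (simp add: simps power_add sq mult.assoc mult.left_commute flip: B'_def)
    next
      case False
      then have "A \<inter> B \<noteq> {}" using B by auto
      then show ?thesis using 3 False by (simp add: simps flip: B'_def)
    qed
  next
    case 4
    then have A: "A = insert k A'" and B: "B = insert k B'" by (auto simp: A'_def B'_def)
    have ne: "A \<inter> B \<noteq> {}" using 4 by auto
    show ?thesis
    proof (cases "A' \<inter> B' = {}")
      case True
      then have dis: "A' \<inter> B = {}" "A \<inter> B' = {}" using A B k' by auto
      have i1: "inversions A' B = (card A' - a) + inversions A' B'"
        using inversions_Un_right[of "{k}" B' A'] k' B par by simp
      have i2: "inversions A B' = b + inversions A' B'"
        using inversions_Un_left[of "{k}" A' B'] k' A by (simp add: b_def)
      have c: "card A = Suc (card A')" using A k' by simp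
      have u: "A' \<union> B = A \<union> B'" using A B by auto
      show ?thesis using 4 ne dis
        by (simp add: simps kA kB i1 i2 c u s power_add sq mult.assoc mult.left_commute
            flip: A'_def B'_def scaleR_left_distrib)
    next
      case False
      then have "A' \<inter> B \<noteq> {}" "A \<inter> B' \<noteq> {}" using A B by auto
      then show ?thesis using 4 ne by (simp add: simps flip: A'_def B'_def)
    qed
  qed
qed

theorem interior_product_unique_existence:
  fixes \<beta> :: "real ^ 'n::{finite,linorder} \<Rightarrow> real"
  assumes \<beta>: "linear \<beta>"
  shows "\<exists>!d. is_interior_product \<beta> d"
proof (rule ex_ex1I)
  define h where "h S = (\<Sum>k\<in>UNIV. \<beta> (axis k 1) *\<^sub>R contract_basis k S)" for S :: "'n set"
  define d where "d x = (\<Sum>S\<in>UNIV. x $ S *\<^sub>R h S)" for x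
  have lin: "linear d" unfolding d_def by (rule linear_coeff_sum)
  have d: "d (ext_basis S) = h S" for S
    unfolding d_def ext_basis_def by (rule coeff_sum_axis)
  have d_sum: "d x = (\<Sum>k\<in>UNIV. \<beta> (axis k 1) *\<^sub>R (\<Sum>S\<in>UNIV. x $ S *\<^sub>R contract_basis k S))" for x
    unfolding d_def h_def scaleR_sum_right
    by (subst sum.swap) (simp add: mult.commute)
  have anti_basis: "d (ext_basis A \<^bold>\<and> ext_basis B) =
      d (ext_basis A) \<^bold>\<and> ext_basis B + (- 1) ^ card A *\<^sub>R (ext_basis A \<^bold>\<and> d (ext_basis B))" for A B
    by (simp only: d_sum contract_basis_antiderivation)
       (simp add: linear_sum[OF linear_wedge_left] linear_sum[OF linear_wedge_right]
        linear_scale[OF linear_wedge_left] linear_scale[OF linear_wedge_right]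
        scaleR_add_right sum.distrib scaleR_sum_right mult_ac)
  have anti_basis': "d (ext_basis A \<^bold>\<and> w) =
      d (ext_basis A) \<^bold>\<and> w + (- 1) ^ card A *\<^sub>R (ext_basis A \<^bold>\<and> d w)" for A w
  proof -
    have "(\<lambda>w. d (ext_basis A \<^bold>\<and> w)) =
       (\<lambda>w. d (ext_basis A) \<^bold>\<and> w + (- 1) ^ card A *\<^sub>R (ext_basis A \<^bold>\<and> d w))"
      by (rule linear_eq_ext_basis)
         (intro linear_compose_add linear_compose_scale_right linear_wedge_right
            linear_compose[OF linear_wedge_right lin, unfolded o_def]
            linear_compose[OF lin linear_wedge_right, unfolded o_def] anti_basis)+
    then show ?thesis by metis
  qed
  have anti: "d (u \<^bold>\<and> w) = d u \<^bold>\<and> w + (- 1) ^ p *\<^sub>R (u \<^bold>\<and> d w)" if "u \<in> ext_grade p" for p u w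
    using that unfolding ext_grade_def
  proof (induction u rule: span_induct_alt)
    case base
    show ?case by (simp add: linear_0[OF linear_wedge_left] linear_0[OF lin])
  next
    case (step c x y)
    then obtain S where S: "x = ext_basis S" "card S = p" by auto
    show ?case using step.IH anti_basis'[of S w] S
      by (simp add: linear_add[OF linear_wedge_left] linear_scale[OF linear_wedge_left]
          linear_add[OF lin] linear_scale[OF lin] scaleR_add_right mult.commute)
  qed
  have grade: "d x \<in> ext_grade p" if "x \<in> ext_grade (Suc p)" for p x
  proof -
    have "contract_basis k S \<in> ext_grade p" if "card S = Suc p" for k S
      using ext_basis_in_grade[of "S - {k}" p] that
      by (auto simp: contract_basis_def ext_grade_def intro: span_scale span_zero)
    then have "d (ext_basis S) \<in> ext_grade p" if "card S = Suc p" for S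
      using that unfolding d h_def ext_grade_def by (intro span_sum span_scale) auto
    then have "d ` {ext_basis S | S. card S = Suc p} \<subseteq> ext_grade p" by auto
    then have "span (d ` {ext_basis S | S. card S = Suc p}) \<subseteq> ext_grade p"
      unfolding ext_grade_def by (rule span_minimal) simp
    then show ?thesis using that linear_span_image[OF lin]
      unfolding ext_grade_def by blast
  qed
  have vec: "d (ext_vec v) = \<beta> v *\<^sub>R ext_one" for v
  proof -
    have h1: "h {k} = \<beta> (axis k 1) *\<^sub>R ext_one" for k
    proof -
      have "h {k} = (\<Sum>l\<in>UNIV. if l = k then \<beta> (axis l 1) *\<^sub>R ext_one else 0)"
        unfolding h_def
        by (intro sum.cong refl)
           (auto simp: contract_basis_def ext_one_def inversions_singleton_insert[of _ "{}", simplified])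
      then show ?thesis by simp
    qed
    have "(\<lambda>v. d (ext_vec v)) = (\<lambda>v. \<beta> v *\<^sub>R ext_one)"
    proof (rule linear_eq_axis)
      show "linear (\<lambda>v. d (ext_vec v))"
        using linear_compose[OF linear_ext_vec lin] by (simp add: o_def)
      show "linear (\<lambda>v. \<beta> v *\<^sub>R (ext_one :: real ^ ('n set)))"
        by (rule linearI) (auto simp: linear_add[OF \<beta>] linear_scale[OF \<beta>] scaleR_add_left)
      show "d (ext_vec (axis k 1)) = \<beta> (axis k 1) *\<^sub>R ext_one" for k
        by (simp add: ext_gen_eq d h1 flip: ext_gen_def)
    qed
    then show ?thesis by metis
  qed
  have one: "d ext_one = 0"
    by (simp add: ext_one_def d h_def contract_basis_def)
  show "\<exists>d. is_interior_product \<beta> d"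
    unfolding is_interior_product_def using lin one grade vec anti by blast
next
  fix d d'
  assume dd: "is_interior_product \<beta> d" "is_interior_product \<beta> d'"
  show "d = d'"
  proof (rule linear_eq_ext_basis)
    show "d (ext_basis S) = d' (ext_basis S)" for S
    proof -
      have "finite S" by simp
      then show ?thesis
      proof (induction S rule: finite_linorder_min_induct)
        case empty
        then show ?case using dd by (simp add: is_interior_product_def ext_one_def)
      next
        case (insert b A)
        then have "ext_basis (insert b A) = ext_vec (axis b 1) \<^bold>\<and> ext_basis A"
          using ext_basis_insert[of A b] by (auto simp: ext_gen_def)
        moreover have "i (ext_vec (axis b 1) \<^bold>\<and> ext_basis A) =
            \<beta> (axis b 1) *\<^sub>R ext_one \<^bold>\<and> ext_basis A - ext_vec (axis b 1) \<^bold>\<and> i (ext_basis A)"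
          if "is_interior_product \<beta> i" for i
        proof -
          have "i (ext_vec (axis b 1) \<^bold>\<and> ext_basis A) = i (ext_vec (axis b 1)) \<^bold>\<and> ext_basis A
              + (- 1) ^ 1 *\<^sub>R (ext_vec (axis b 1) \<^bold>\<and> i (ext_basis A))"
            using that ext_vec_in_grade unfolding is_interior_product_def by blast
          moreover have "i (ext_vec (axis b 1)) = \<beta> (axis b 1) *\<^sub>R ext_one"
            using that unfolding is_interior_product_def by blast
          ultimately show ?thesis by (simp add: linear_scale[OF linear_wedge_left])
        qed
        ultimately show ?case using dd insert.IH by metis
      qed
    qed
  qed (use dd in \<open>auto simp: is_interior_product_def\<close>)
qed

lemma is_interior_product_interior_product:
  "linear \<beta> \<Longrightarrow> is_interior_product \<beta> (interior_product \<beta>)"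
  unfolding interior_product_def by (rule theI'[OF interior_product_unique_existence])


section \<open>The permutation action\<close>

definition vec_perm :: "('n \<Rightarrow> 'n) \<Rightarrow> real ^ 'n \<Rightarrow> real ^ 'n" where
  "vec_perm \<sigma> v = (\<Sum>k\<in>UNIV. v $ k *\<^sub>R axis (\<sigma> k) 1)"

definition ext_perm ::
  "('n \<Rightarrow> 'n) \<Rightarrow> real ^ ('n::{finite,linorder} set) \<Rightarrow> real ^ ('n set)" where
  "ext_perm \<sigma> = (THE g. is_exterior_extension (\<^bold>\<and>) ext_one (\<lambda>v. ext_vec (vec_perm \<sigma> v)) g)"

lemma linear_vec_perm: "linear (vec_perm \<sigma>)"
  unfolding vec_perm_def by (rule linear_coeff_sum)

lemma ext_perm_ex1: "\<exists>!g. is_exterior_extension (\<^bold>\<and>) ext_one (\<lambda>v. ext_vec (vec_perm \<sigma> v)) g"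
  by (rule exterior_universal_property)
     (auto simp: bilinear_wedge wedge_assoc ext_vec_square
       intro: linear_compose[OF linear_vec_perm linear_ext_vec, unfolded o_def])

lemma is_exterior_extension_ext_perm:
  "is_exterior_extension (\<^bold>\<and>) ext_one (\<lambda>v. ext_vec (vec_perm \<sigma> v)) (ext_perm \<sigma>)"
  unfolding ext_perm_def by (rule theI'[OF ext_perm_ex1])

lemma ext_perm_linear: "linear (ext_perm \<sigma>)"
  and ext_perm_one: "ext_perm \<sigma> ext_one = ext_one"
  and ext_perm_wedge: "ext_perm \<sigma> (u \<^bold>\<and> w) = ext_perm \<sigma> u \<^bold>\<and> ext_perm \<sigma> w"
  and ext_perm_gen: "ext_perm \<sigma> (ext_gen k) = ext_gen (\<sigma> k)"
  using is_exterior_extension_ext_perm[of \<sigma>]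
  by (auto simp: is_exterior_extension_def ext_gen_def vec_perm_def coeff_sum_axis)


section \<open>Tensor products\<close>

text \<open>
  The tensor product of \<open>real ^ 'a\<close> and \<open>real ^ 'b\<close> is \<open>real ^ ('a \<times> 'b)\<close>; the tensor product of
  subspaces is the span of the pure tensors inside it.
\<close>

definition tensor :: "real ^ 'a \<Rightarrow> real ^ 'b \<Rightarrow> real ^ ('a \<times> 'b)" (infixr "\<otimes>" 70) where
  "u \<otimes> w = (\<chi> p. u $ fst p * w $ snd p)"

definition tensor_space ::
  "(real ^ 'a) set \<Rightarrow> (real ^ 'b) set \<Rightarrow> (real ^ ('a \<times> 'b)) set" (infixr "\<otimes>\<^sub>S" 70) where
  "A \<otimes>\<^sub>S B = span {u \<otimes> w | u w. u \<in> A \<and> w \<in> B}"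

definition tensor_map ::
  "(real ^ 'a \<Rightarrow> real ^ 'c) \<Rightarrow> (real ^ 'b \<Rightarrow> real ^ 'd)
    \<Rightarrow> real ^ ('a \<times> 'b) \<Rightarrow> real ^ ('c \<times> 'd)" (infixr "\<otimes>\<^sub>M" 70) where
  "f \<otimes>\<^sub>M g = (THE h. linear h \<and> (\<forall>u w. h (u \<otimes> w) = f u \<otimes> g w))"

lemma bilinear_tensor: "bilinear (\<otimes>)"
  by (auto simp: bilinear_def tensor_def vec_eq_iff algebra_simps intro!: linearI)

lemma axis_tensor: "axis (i, j) 1 = axis i 1 \<otimes> axis j 1"
  by (auto simp: tensor_def vec_eq_iff axis_def)

theorem tensor_universal_property:
  fixes b :: "real ^ 'a \<Rightarrow> real ^ 'b \<Rightarrow> 'c::real_vector"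
  assumes b: "bilinear b"
  shows "\<exists>!h. linear h \<and> (\<forall>u w. h (u \<otimes> w) = b u w)"
proof (rule ex_ex1I)
  define h where "h x = (\<Sum>p\<in>UNIV. x $ p *\<^sub>R b (axis (fst p) 1) (axis (snd p) 1))"
    for x :: "real ^ ('a \<times> 'b)"
  have lin: "linear h" unfolding h_def by (rule linear_coeff_sum)
  have lb: "linear (\<lambda>y. b x y)" "linear (\<lambda>x. b x y)" for x y using b by (auto simp: bilinear_def)
  have lt: "linear (\<lambda>y. x \<otimes> y)" "linear (\<lambda>x. x \<otimes> y)" for x :: "real ^ 'a" and y :: "real ^ 'b"
    using bilinear_tensor by (auto simp: bilinear_def)
  have 0: "h (axis i 1 \<otimes> axis j 1) = b (axis i 1) (axis j 1)" for i j
    by (simp add: h_def coeff_sum_axis flip: axis_tensor)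
  have 1: "(\<lambda>w. h (axis i 1 \<otimes> w)) = (\<lambda>w. b (axis i 1) w)" for i
    by (rule linear_eq_axis[OF linear_compose[OF lt(1) lin, unfolded o_def] lb(1) 0])
  have 2: "(\<lambda>u. h (u \<otimes> w)) = (\<lambda>u. b u w)" for w
    by (rule linear_eq_axis[OF linear_compose[OF lt(2) lin, unfolded o_def] lb(2) fun_cong[OF 1]])
  show "\<exists>h. linear h \<and> (\<forall>u w. h (u \<otimes> w) = b u w)"
    using lin fun_cong[OF 2] by blast
next
  fix h h' :: "real ^ ('a \<times> 'b) \<Rightarrow> 'c"
  assume "linear h \<and> (\<forall>u w. h (u \<otimes> w) = b u w)" "linear h' \<and> (\<forall>u w. h' (u \<otimes> w) = b u w)"
  then show "h = h'"
    by (intro linear_eq_axis) (auto simp: axis_tensor)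
qed

lemma tensor_map:
  assumes "linear f" "linear g"
  shows tensor_map_linear: "linear (f \<otimes>\<^sub>M g)"
    and tensor_map_tensor: "(f \<otimes>\<^sub>M g) (u \<otimes> w) = f u \<otimes> g w"
proof -
  have "bilinear (\<lambda>u w. f u \<otimes> g w)"
    by (auto simp: bilinear_def tensor_def vec_eq_iff algebra_simps linear_add[OF assms(1)]
        linear_add[OF assms(2)] linear_scale[OF assms(1)] linear_scale[OF assms(2)] intro!: linearI)
  from theI'[OF tensor_universal_property[OF this]]
  show "linear (f \<otimes>\<^sub>M g)" "(f \<otimes>\<^sub>M g) (u \<otimes> w) = f u \<otimes> g w"
    unfolding tensor_map_def by auto
qed


section \<open>Graded representations of the symmetric group\<close>

definition graded_sym_rep ::
  "(('n::finite \<Rightarrow> 'n) \<Rightarrow> 'v \<Rightarrow> 'v::real_vector) \<Rightarrow> (nat \<Rightarrow> 'v set) \<Rightarrow> bool" where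
  "graded_sym_rep \<rho> V \<longleftrightarrow>
     (\<forall>i. subspace (V i)) \<and>
     (\<forall>\<sigma>. bij \<sigma> \<longrightarrow> linear (\<rho> \<sigma>) \<and> (\<forall>i. \<rho> \<sigma> ` V i \<subseteq> V i)) \<and>
     \<rho> id = id \<and>
     (\<forall>\<sigma> \<tau>. bij \<sigma> \<and> bij \<tau> \<longrightarrow> \<rho> (\<sigma> \<circ> \<tau>) = \<rho> \<sigma> \<circ> \<rho> \<tau>)"

definition sym_rep_inclusion ::
  "(('n::finite \<Rightarrow> 'n) \<Rightarrow> 'v \<Rightarrow> 'v::real_vector) \<Rightarrow> ('v \<Rightarrow> 'v) \<Rightarrow> 'v set \<Rightarrow> 'v set \<Rightarrow> bool" where
  "sym_rep_inclusion \<rho> f A B \<longleftrightarrow>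
     f ` A \<subseteq> B \<and>
     (\<forall>x\<in>A. \<forall>y\<in>A. f (x + y) = f x + f y) \<and>
     (\<forall>c. \<forall>x\<in>A. f (c *\<^sub>R x) = c *\<^sub>R f x) \<and>
     inj_on f A \<and>
     (\<forall>\<sigma>. bij \<sigma> \<longrightarrow> (\<forall>x\<in>A. f (\<rho> \<sigma> x) = \<rho> \<sigma> (f x)))"

definition sym_rep_included ::
  "(('n::finite \<Rightarrow> 'n) \<Rightarrow> 'v \<Rightarrow> 'v::real_vector) \<Rightarrow> 'v set \<Rightarrow> 'v set \<Rightarrow> bool" where
  "sym_rep_included \<rho> A B \<longleftrightarrow> (\<exists>f. sym_rep_inclusion \<rho> f A B)"

definition tensor_square_action ::
  "(('n \<Rightarrow> 'n) \<Rightarrow> real ^ 'a \<Rightarrow> real ^ 'a) \<Rightarrow> ('n \<Rightarrow> 'n) \<Rightarrow> real ^ ('a \<times> 'a) \<Rightarrow> real ^ ('a \<times> 'a)" where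
  "tensor_square_action \<rho> \<sigma> = \<rho> \<sigma> \<otimes>\<^sub>M \<rho> \<sigma>"

text \<open>
  The chain \<open>V\<^sup>0 \<otimes> V\<^sup>m \<subset> V\<^sup>1 \<otimes> V\<^bsup>m-1\<^esup> \<subset> \<dots>\<close> ends at index \<open>\<lfloor>m/2\<rfloor>\<close>, that is at
  \<open>V\<^bsup>m/2\<^esup> \<otimes> V\<^bsup>m/2\<^esup>\<close> for even \<open>m\<close> and at \<open>V\<^bsup>(m-1)/2\<^esup> \<otimes> V\<^bsup>(m+1)/2\<^esup>\<close> for odd \<open>m\<close>.
\<close>

definition log_concave_chain ::
  "(('n::finite \<Rightarrow> 'n) \<Rightarrow> real ^ 'a \<Rightarrow> real ^ 'a) \<Rightarrow> (nat \<Rightarrow> (real ^ 'a) set) \<Rightarrow> nat \<Rightarrow> bool" where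
  "log_concave_chain \<rho> V m \<longleftrightarrow>
     (\<forall>i\<in>{1..m div 2}. sym_rep_included (tensor_square_action \<rho>)
        (V (i - 1) \<otimes>\<^sub>S V (m - i + 1)) (V i \<otimes>\<^sub>S V (m - i)))"

definition strongly_equivariantly_log_concave ::
  "(('n::finite \<Rightarrow> 'n) \<Rightarrow> real ^ 'a \<Rightarrow> real ^ 'a) \<Rightarrow> (nat \<Rightarrow> (real ^ 'a) set) \<Rightarrow> bool" where
  "strongly_equivariantly_log_concave \<rho> V \<longleftrightarrow>
     graded_sym_rep \<rho> V \<and> (\<forall>m. log_concave_chain \<rho> V m)"

definition lefschetz_op ::
  "real ^ ('n::{finite,linorder} set \<times> 'n set) \<Rightarrow> real ^ ('n set \<times> 'n set)" where
  "lefschetz_op t =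
     (\<Sum>k\<in>UNIV. ((\<lambda>u. ext_gen k \<^bold>\<and> u) \<otimes>\<^sub>M interior_product (\<lambda>v. v $ k)) t)"

end

theory Submission
  imports Defs
begin

text \<open>
  The point is that \<open>L = \<Sum>\<^sub>k e\<^sub>k \<otimes> i\<^sub>k\<close> is half of an \<open>sl\<^sub>2\<close>-triple whose other half is its adjoint. For the
  inner product on \<open>\<Lambda>\<close> that makes the monomials orthonormal, \<open>i\<^sub>k\<close> is the adjoint of \<open>e\<^sub>k\<close>
  (\<open>inner_wedge_gen\<close>), so the adjoint of \<open>L\<close> is \<open>R = \<Sum>\<^sub>k i\<^sub>k \<otimes> e\<^sub>k\<close>. The antiderivation rule gives
  \<open>i\<^sub>l e\<^sub>k + e\<^sub>k i\<^sub>l = \<delta>\<^sub>k\<^sub>l\<close>. In \<open>L R - R L\<close> the terms with \<open>k \<noteq> l\<close> cancel, because moving \<open>i\<^sub>l\<close> past \<open>e\<^sub>k\<close>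
  changes the sign in both tensor factors; the diagonal terms leave \<open>N \<otimes> 1 - 1 \<otimes> N\<close>, where
  \<open>N = \<Sum>\<^sub>k e\<^sub>k i\<^sub>k\<close> multiplies \<open>V\<^sup>p\<close> by \<open>p\<close>. Hence \<open>L R - R L = p - q\<close> on \<open>V\<^sup>p \<otimes> V\<^sup>q\<close>
  (\<open>lefschetz_commutator\<close>), and therefore
  \<open>|L x|\<^sup>2 = x \<bullet> R L x = |R x|\<^sup>2 + (q - p) |x|\<^sup>2\<close> there (\<open>norm_lefschetz_op\<close>).
  For \<open>p < q\<close> this forces \<open>x = 0\<close> whenever \<open>L x = 0\<close>. In the chain \<open>p = i - 1\<close> and
  \<open>q = m - i + 1\<close> with \<open>2 i \<le> m\<close>, so \<open>p < q\<close> always holds.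

  Equivariance holds because a permutation \<open>\<sigma>\<close> carries \<open>e\<^sub>k\<close> to \<open>e\<^bsub>\<sigma> k\<^esub>\<close> and \<open>i\<^sub>k\<close> to \<open>i\<^bsub>\<sigma> k\<^esub>\<close>, so it
  only permutes the summands of \<open>L\<close>.
\<close>

section \<open>Wedging with a generator and contracting by its dual\<close>

abbreviation contract :: "'n \<Rightarrow> real ^ ('n::{finite,linorder} set) \<Rightarrow> real ^ ('n set)" where
  "contract k \<equiv> interior_product (\<lambda>v. v $ k)"

lemma contract_is_interior_product: "is_interior_product (\<lambda>v. v $ k) (contract k)"
  by (rule is_interior_product_interior_product) (rule linearI; simp)

lemma linear_contract: "linear (contract k)"
  and contract_one: "contract k ext_one = 0"
  and contract_in_grade: "u \<in> ext_grade (Suc p) \<Longrightarrow> contract k u \<in> ext_grade p"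
  using contract_is_interior_product[of k] by (auto simp: is_interior_product_def)

text \<open>
  This is the antiderivation rule for a left factor of degree 1, read as the canonical
  anticommutation relation between creation and annihilation operators.
\<close>

lemma contract_wedge_gen:
  "contract k (ext_gen l \<^bold>\<and> u) = (if k = l then u else 0) - ext_gen l \<^bold>\<and> contract k u"
proof -
  have "contract k (ext_gen l \<^bold>\<and> u) =
      contract k (ext_gen l) \<^bold>\<and> u + (- 1) ^ 1 *\<^sub>R (ext_gen l \<^bold>\<and> contract k u)"
    using contract_is_interior_product[of k] ext_vec_in_grade[of "axis l 1"]
    unfolding is_interior_product_def ext_gen_def by blast
  moreover have "contract k (ext_gen l) = (axis l 1 $ k) *\<^sub>R ext_one"
    using contract_is_interior_product[of k] unfolding is_interior_product_def ext_gen_def by blast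
  ultimately show ?thesis
    by (auto simp: axis_def linear_scale[OF linear_wedge_left] linear_0[OF linear_wedge_left])
qed

text \<open>
  Every monomial arises from 1 by wedging with generators, so linear maps can be compared along
  these steps, where the behaviour of contractions and permutations is explicit.
\<close>

lemma linear_eq_ext_generators:
  fixes f g :: "real ^ ('n::{finite,linorder} set) \<Rightarrow> 'b::real_vector"
  assumes "linear f" "linear g" and one: "f ext_one = g ext_one"
    and gen: "\<And>k u. f u = g u \<Longrightarrow> f (ext_gen k \<^bold>\<and> u) = g (ext_gen k \<^bold>\<and> u)"
  shows "f = g"
proof (rule linear_eq_ext_basis[OF assms(1,2)])
  fix S :: "'n set"
  have "finite S" by simp
  then show "f (ext_basis S) = g (ext_basis S)"
  proof (induction S rule: finite_linorder_min_induct)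
    case empty
    then show ?case using one by (simp add: ext_one_def)
  next
    case (insert b A)
    then show ?case using gen by (simp add: ext_basis_insert)
  qed
qed

lemma wedge_gen_basis:
  "ext_gen k \<^bold>\<and> ext_basis S =
     (if k \<in> S then 0 else (- 1) ^ inversions {k} S *\<^sub>R ext_basis (insert k S))"
  by (simp add: ext_gen_eq wedge_ext_basis wedge_basis_def)

lemma contract_basis_absent:
  assumes "k \<notin> S"
  shows "contract k (ext_basis S) = 0"
proof -
  have "finite S" by simp
  then show ?thesis using assms
  proof (induction S rule: finite_linorder_min_induct)
    case empty
    then show ?case using contract_one[of k] by (simp add: ext_one_def)
  next
    case (insert b A)
    then show ?case
      by (simp add: ext_basis_insert contract_wedge_gen linear_0[OF linear_wedge_right])
  qed
qed

text \<open>
  For \<open>k \<in> S\<close> the monomial is, up to sign, \<open>\<alpha>\<^sub>k\<close> wedged with the monomial of \<open>S - {k}\<close>; the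
  anticommutation relation then strips \<open>\<alpha>\<^sub>k\<close> off, since \<open>i\<^sub>k\<close> kills the monomial of \<open>S - {k}\<close>.
\<close>

lemma contract_ext_basis: "contract k (ext_basis S) = contract_basis k S"
proof (cases "k \<in> S")
  case True
  define s where "s = (- 1 :: real) ^ inversions {k} S"
  have ss: "s * s = 1" by (simp add: s_def flip: power_mult_distrib)
  have "ext_gen k \<^bold>\<and> ext_basis (S - {k}) = s *\<^sub>R ext_basis S"
    using True by (simp add: wedge_gen_basis s_def inversions_singleton_remove insert_absorb)
  then have "ext_basis S = s *\<^sub>R (ext_gen k \<^bold>\<and> ext_basis (S - {k}))"
    by (simp add: ss)
  then have "contract k (ext_basis S) = s *\<^sub>R ext_basis (S - {k})"
    by (simp add: linear_scale[OF linear_contract] contract_wedge_gen contract_basis_absent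
        linear_0[OF linear_wedge_right])
  with True show ?thesis by (simp add: contract_basis_def s_def)
qed (simp add: contract_basis_absent contract_basis_def)

lemma wedge_gen_contract_basis:
  "ext_gen k \<^bold>\<and> contract k (ext_basis S) = (if k \<in> S then ext_basis S else 0)"
  by (auto simp: contract_ext_basis contract_basis_def wedge_gen_basis
      linear_scale[OF linear_wedge_right] linear_0[OF linear_wedge_right]
      inversions_singleton_remove insert_absorb simp flip: power_mult_distrib)

text \<open>The number operator \<open>N = \<Sum>\<^sub>k e\<^sub>k i\<^sub>k\<close> counts the generators that occur in a monomial.\<close>

lemma number_operator:
  fixes u :: "real ^ ('n::{finite,linorder} set)"
  assumes "u \<in> ext_grade p"
  shows "(\<Sum>k\<in>UNIV. ext_gen k \<^bold>\<and> contract k u) = real p *\<^sub>R u"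
proof -
  have lin: "linear (\<lambda>u::real ^ ('n set). \<Sum>k\<in>UNIV. ext_gen k \<^bold>\<and> contract k u)"
    by (intro linear_compose_sum ballI linear_compose[OF linear_contract linear_wedge_right, unfolded o_def])
  have "(\<Sum>k\<in>UNIV. ext_gen k \<^bold>\<and> contract k (ext_basis S)) = real (card S) *\<^sub>R ext_basis S"
    for S :: "'n set"
    by (simp add: wedge_gen_contract_basis sum_constant_scaleR del: sum_constant flip: sum.inter_filter)
  then show ?thesis
    by (intro linear_eq_on_span[OF lin linear_scale_self _ assms[unfolded ext_grade_def]]) auto
qed

lemma wedge_gen_in_grade:
  fixes u :: "real ^ ('n::{finite,linorder} set)"
  assumes "u \<in> ext_grade p"
  shows "ext_gen k \<^bold>\<and> u \<in> ext_grade (Suc p)"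
  using assms unfolding ext_grade_def
proof (induction u rule: span_induct_alt)
  case base
  show ?case by (simp add: linear_0[OF linear_wedge_right] span_zero)
next
  case (step c x y)
  then obtain S where S: "x = ext_basis S" "card S = p" by auto
  have "ext_gen k \<^bold>\<and> x \<in> span {ext_basis S |S. card S = Suc p}"
  proof (cases "k \<in> S")
    case False
    with S have "ext_basis (insert k S) \<in> span {ext_basis S |S. card S = Suc p}"
      using ext_basis_in_grade[of "insert k S" "Suc p"] by (simp add: ext_grade_def)
    with False S show ?thesis by (simp add: wedge_gen_basis span_scale)
  qed (simp add: S wedge_gen_basis span_zero)
  with step show ?case
    by (simp add: linear_add[OF linear_wedge_right] linear_scale[OF linear_wedge_right]
        span_add span_scale)
qed


section \<open>Adjoints\<close>

lemma inner_eq_axis: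
  fixes f :: "real ^ 'a \<Rightarrow> real ^ 'b" and g :: "real ^ 'b \<Rightarrow> real ^ 'a"
  assumes f: "linear f" and g: "linear g"
    and ax: "\<And>i j. f (axis i 1) \<bullet> axis j 1 = axis i 1 \<bullet> g (axis j 1)"
  shows "f x \<bullet> y = x \<bullet> g y"
proof -
  have li: "linear (\<lambda>y. z \<bullet> y)" "linear (\<lambda>x. x \<bullet> z)" for z :: "real ^ 'c"
    by (auto intro!: linearI simp: inner_add_left inner_add_right)
  have 1: "(\<lambda>y. f (axis i 1) \<bullet> y) = (\<lambda>y. axis i 1 \<bullet> g y)" for i
    by (rule linear_eq_axis[OF li(1) linear_compose[OF g li(1), unfolded o_def] ax])
  have "(\<lambda>x. f x \<bullet> y) = (\<lambda>x. x \<bullet> g y)"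
    by (rule linear_eq_axis[OF linear_compose[OF f li(2), unfolded o_def] li(2) fun_cong[OF 1]])
  then show ?thesis by metis
qed

lemma inner_ext_basis: "ext_basis S \<bullet> ext_basis T = (if S = T then 1 else 0)"
  by (simp add: ext_basis_def inner_axis_axis)

lemma inner_wedge_gen:
  fixes u w :: "real ^ ('n::{finite,linorder} set)"
  shows "(ext_gen k \<^bold>\<and> u) \<bullet> w = u \<bullet> contract k w"
proof (rule inner_eq_axis[OF linear_wedge_right linear_contract])
  fix A B :: "'n set"
  have "(ext_gen k \<^bold>\<and> ext_basis A) \<bullet> ext_basis B = ext_basis A \<bullet> contract k (ext_basis B)"
    by (auto simp: contract_ext_basis wedge_gen_basis contract_basis_def
        inner_ext_basis inversions_singleton_remove)
  then show "(ext_gen k \<^bold>\<and> axis A 1) \<bullet> axis B 1 = axis A 1 \<bullet> contract k (axis B 1)"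
    unfolding ext_basis_def .
qed

lemma inner_tensor: "(u \<otimes> w) \<bullet> (u' \<otimes> w') = (u \<bullet> u') * (w \<bullet> w')"
  by (simp add: tensor_def inner_vec_def sum_product sum.cartesian_product case_prod_unfold mult_ac)

lemma inner_tensor_map:
  assumes lin: "linear f" "linear f'" "linear g" "linear g'"
    and "\<And>u w. f u \<bullet> w = u \<bullet> f' w" "\<And>u w. g u \<bullet> w = u \<bullet> g' w"
  shows "(f \<otimes>\<^sub>M g) x \<bullet> y = x \<bullet> (f' \<otimes>\<^sub>M g') y"
proof (rule inner_eq_axis)
  show "(f \<otimes>\<^sub>M g) (axis i 1) \<bullet> axis j 1 = axis i 1 \<bullet> (f' \<otimes>\<^sub>M g') (axis j 1)" for i j
    using assms by (cases i; cases j) (simp add: axis_tensor tensor_map_tensor inner_tensor)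
qed (intro tensor_map_linear lin)+


section \<open>The operator \<open>L\<close> and its adjoint\<close>

lemma tensor_linear: "linear (\<lambda>u. u \<otimes> w)" "linear (\<lambda>w. u \<otimes> w)"
  using bilinear_tensor by (auto simp: bilinear_def)

lemma linear_eq_tensor:
  fixes f g :: "real ^ ('a::finite \<times> 'b::finite) \<Rightarrow> 'c::real_vector"
  assumes "linear f" "linear g" "\<And>u w. f (u \<otimes> w) = g (u \<otimes> w)"
  shows "f = g"
  by (rule linear_eq_axis[OF assms(1,2)]) (auto simp: axis_tensor assms(3))

lemma linear_lefschetz_op: "linear lefschetz_op"
  unfolding lefschetz_op_def
  by (intro linear_compose_sum ballI tensor_map_linear linear_wedge_right linear_contract)

lemma lefschetz_op_tensor:
  "lefschetz_op (u \<otimes> w) = (\<Sum>k\<in>UNIV. (ext_gen k \<^bold>\<and> u) \<otimes> contract k w)"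
  by (simp add: lefschetz_op_def tensor_map_tensor linear_wedge_right linear_contract)

text \<open>The adjoint of \<open>L\<close> (\<open>inner_lefschetz_op\<close>), called \<open>R\<close> in the introduction.\<close>

definition lowering_op ::
  "real ^ ('n::{finite,linorder} set \<times> 'n set) \<Rightarrow> real ^ ('n set \<times> 'n set)" where
  "lowering_op t = (\<Sum>k\<in>UNIV. (contract k \<otimes>\<^sub>M (\<lambda>u. ext_gen k \<^bold>\<and> u)) t)"

lemma linear_lowering_op: "linear lowering_op"
  unfolding lowering_op_def
  by (intro linear_compose_sum ballI tensor_map_linear linear_wedge_right linear_contract)

lemma lowering_op_tensor:
  "lowering_op (u \<otimes> w) = (\<Sum>k\<in>UNIV. contract k u \<otimes> (ext_gen k \<^bold>\<and> w))"
  by (simp add: lowering_op_def tensor_map_tensor linear_wedge_right linear_contract)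

lemma inner_lefschetz_op: "lefschetz_op x \<bullet> y = x \<bullet> lowering_op y"
  unfolding lefschetz_op_def lowering_op_def inner_sum_left inner_sum_right
proof (intro sum.cong refl inner_tensor_map linear_wedge_right linear_contract inner_wedge_gen)
  show "contract k u \<bullet> w = u \<bullet> (ext_gen k \<^bold>\<and> w)" for k :: 'a and u w
    using inner_wedge_gen[of k w u] by (simp add: inner_commute)
qed

text \<open>
  The \<open>sl\<^sub>2\<close> relation. On a pure tensor, with \<open>a = e\<^sub>k i\<^sub>l u\<close> and \<open>b = e\<^sub>l i\<^sub>k w\<close>, the \<open>(k, l)\<close> term of \<open>L R - R L\<close> is
  \<open>a \<otimes> (\<delta> w - b) - (\<delta> u - a) \<otimes> b = \<delta> (a \<otimes> w - u \<otimes> b)\<close>; only the number operators of the two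
  factors survive.
\<close>

lemma lefschetz_commutator_tensor:
  assumes u: "u \<in> ext_grade p" and w: "w \<in> ext_grade q"
  shows "lefschetz_op (lowering_op (u \<otimes> w)) - lowering_op (lefschetz_op (u \<otimes> w)) =
    (real p - real q) *\<^sub>R (u \<otimes> w)"
proof -
  define a where "a k l = ext_gen k \<^bold>\<and> contract l u" for k l
  define b where "b k l = ext_gen l \<^bold>\<and> contract k w" for k l
  define d where "d k l x = (if k = l then x else 0)" for k l :: 'a and x :: "real ^ ('a set)"
  have "lefschetz_op (lowering_op (u \<otimes> w)) = (\<Sum>l\<in>UNIV. \<Sum>k\<in>UNIV. a k l \<otimes> (d k l w - b k l))"
    by (simp add: lowering_op_tensor linear_sum[OF linear_lefschetz_op] lefschetz_op_tensor
        contract_wedge_gen a_def b_def d_def)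
  then have LR: "lefschetz_op (lowering_op (u \<otimes> w)) =
      (\<Sum>k\<in>UNIV. \<Sum>l\<in>UNIV. a k l \<otimes> (d k l w - b k l))"
    by (subst sum.swap)
  have "contract l (ext_gen k \<^bold>\<and> u) = d k l u - a k l" for k l
    by (auto simp: contract_wedge_gen a_def d_def)
  then have RL: "lowering_op (lefschetz_op (u \<otimes> w)) =
      (\<Sum>k\<in>UNIV. \<Sum>l\<in>UNIV. (d k l u - a k l) \<otimes> b k l)"
    by (simp add: lefschetz_op_tensor linear_sum[OF linear_lowering_op] lowering_op_tensor b_def)
  have kl: "a k l \<otimes> (d k l w - b k l) - (d k l u - a k l) \<otimes> b k l =
      (if k = l then a k k \<otimes> w - u \<otimes> b k k else 0)" for k l
    by (simp add: d_def linear_diff[OF tensor_linear(1)] linear_diff[OF tensor_linear(2)]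
        linear_0[OF tensor_linear(1)] linear_0[OF tensor_linear(2)])
  have "lefschetz_op (lowering_op (u \<otimes> w)) - lowering_op (lefschetz_op (u \<otimes> w)) =
      (\<Sum>k\<in>UNIV. a k k \<otimes> w - u \<otimes> b k k)"
    unfolding LR RL sum_subtractf[symmetric] kl by simp
  also have "\<dots> = (\<Sum>k\<in>UNIV. a k k) \<otimes> w - u \<otimes> (\<Sum>k\<in>UNIV. b k k)"
    by (simp add: sum_subtractf linear_sum[OF tensor_linear(1)] linear_sum[OF tensor_linear(2)])
  also have "\<dots> = (real p - real q) *\<^sub>R (u \<otimes> w)"
    by (simp add: a_def b_def number_operator[OF u] number_operator[OF w]
        linear_scale[OF tensor_linear(1)] linear_scale[OF tensor_linear(2)] scaleR_diff_left)
  finally show ?thesis .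
qed

lemma lefschetz_commutator:
  assumes "x \<in> ext_grade p \<otimes>\<^sub>S ext_grade q"
  shows "lefschetz_op (lowering_op x) - lowering_op (lefschetz_op x) = (real p - real q) *\<^sub>R x"
proof -
  have "linear (\<lambda>x. lefschetz_op (lowering_op x) - lowering_op (lefschetz_op x))"
    by (intro linear_compose_sub
        linear_compose[OF linear_lowering_op linear_lefschetz_op, unfolded o_def]
        linear_compose[OF linear_lefschetz_op linear_lowering_op, unfolded o_def])
  then show ?thesis
    by (rule linear_eq_on_span[OF _ linear_scale_self _ assms[unfolded tensor_space_def]])
       (auto simp: lefschetz_commutator_tensor)
qed

text \<open>
  Moving \<open>L\<close> to the other side of \<open>L x \<bullet> L x\<close> gives \<open>x \<bullet> R L x\<close>; exchanging \<open>R\<close> and \<open>L\<close> then costs a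
  multiple of \<open>|x|\<^sup>2\<close> that is positive exactly below the middle of the chain, where \<open>p < q\<close>.
\<close>

lemma norm_lefschetz_op:
  assumes "x \<in> ext_grade p \<otimes>\<^sub>S ext_grade q"
  shows "(norm (lefschetz_op x))\<^sup>2 =
    (norm (lowering_op x))\<^sup>2 + (real q - real p) * (norm x)\<^sup>2"
proof -
  have "lowering_op (lefschetz_op x) = lefschetz_op (lowering_op x) + (real q - real p) *\<^sub>R x"
    using lefschetz_commutator[OF assms] by (simp add: algebra_simps)
  then have "(norm (lefschetz_op x))\<^sup>2 =
      x \<bullet> lefschetz_op (lowering_op x) + (real q - real p) * (norm x)\<^sup>2"
    by (simp add: power2_norm_eq_inner inner_lefschetz_op inner_add_right)
  also have "x \<bullet> lefschetz_op (lowering_op x) = (norm (lowering_op x))\<^sup>2"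
    by (simp add: power2_norm_eq_inner inner_commute[of x] inner_lefschetz_op)
  finally show ?thesis .
qed

lemma lefschetz_op_inj_on:
  assumes "p < q"
  shows "inj_on lefschetz_op (ext_grade p \<otimes>\<^sub>S ext_grade q)"
proof -
  have "x = 0" if x: "x \<in> ext_grade p \<otimes>\<^sub>S ext_grade q" "lefschetz_op x = 0"
    for x :: "real ^ ('n::{finite,linorder} set \<times> 'n set)"
  proof (rule ccontr)
    assume "x \<noteq> 0"
    then have "0 < (real q - real p) * (norm x)\<^sup>2" using assms by simp
    with norm_lefschetz_op[OF x(1)] x(2) show False
      using zero_le_power2[of "norm (lowering_op x)"] by simp
  qed
  moreover have "subspace (ext_grade p \<otimes>\<^sub>S ext_grade q)" by (simp add: tensor_space_def)
  ultimately show ?thesis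
    using linear_injective_on_subspace_0[OF linear_lefschetz_op] by blast
qed

lemma lefschetz_op_in_grade:
  assumes "x \<in> ext_grade p \<otimes>\<^sub>S ext_grade (Suc q)"
  shows "lefschetz_op x \<in> ext_grade (Suc p) \<otimes>\<^sub>S ext_grade q"
  using assms unfolding tensor_space_def
proof (induction x rule: span_induct_alt)
  case base
  show ?case by (simp add: linear_0[OF linear_lefschetz_op] span_zero)
next
  case (step c x y)
  then obtain u w where "x = u \<otimes> w" "u \<in> ext_grade p" "w \<in> ext_grade (Suc q)" by auto
  then have "lefschetz_op x \<in> span {u \<otimes> w |u w. u \<in> ext_grade (Suc p) \<and> w \<in> ext_grade q}"
    unfolding \<open>x = u \<otimes> w\<close> lefschetz_op_tensor
    by (intro span_sum span_base) (blast intro: wedge_gen_in_grade contract_in_grade)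
  with step show ?case
    by (simp add: linear_add[OF linear_lefschetz_op] linear_scale[OF linear_lefschetz_op]
        span_add span_scale)
qed


section \<open>Equivariance\<close>

lemma ext_perm_in_grade:
  assumes "u \<in> ext_grade p"
  shows "ext_perm \<sigma> u \<in> ext_grade p"
proof -
  have basis: "ext_perm \<sigma> (ext_basis S) \<in> ext_grade (card S)" for S
  proof -
    have "finite S" by simp
    then show ?thesis
    proof (induction S rule: finite_linorder_min_induct)
      case empty
      then show ?case using ext_perm_one[of \<sigma>] ext_basis_in_grade[of "{}"] by (simp add: ext_one_def)
    next
      case (insert b A)
      then have "b \<notin> A" by blast
      with insert show ?case
        by (simp add: ext_basis_insert ext_perm_wedge ext_perm_gen wedge_gen_in_grade)
    qed
  qed
  show ?thesis using assms unfolding ext_grade_def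
  proof (induction u rule: span_induct_alt)
    case base
    show ?case by (simp add: linear_0[OF ext_perm_linear] span_zero)
  next
    case (step c x y)
    then have "ext_perm \<sigma> x \<in> span {ext_basis S |S. card S = p}"
      using basis unfolding ext_grade_def by auto
    with step show ?case
      by (simp add: linear_add[OF ext_perm_linear] linear_scale[OF ext_perm_linear]
          span_add span_scale)
  qed
qed

lemma ext_perm_id: "ext_perm id = id"
  by (rule linear_eq_ext_generators[OF ext_perm_linear])
     (auto simp: ext_perm_one ext_perm_wedge ext_perm_gen linear_id)

lemma ext_perm_comp: "ext_perm (\<sigma> \<circ> \<tau>) = ext_perm \<sigma> \<circ> ext_perm \<tau>"
  by (rule linear_eq_ext_generators[OF ext_perm_linear linear_compose[OF ext_perm_linear ext_perm_linear]])
     (auto simp: ext_perm_one ext_perm_wedge ext_perm_gen)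

lemma graded_sym_rep_ext_perm: "graded_sym_rep ext_perm ext_grade"
  unfolding graded_sym_rep_def
  by (auto simp: ext_perm_linear ext_perm_id ext_perm_comp ext_perm_in_grade)
     (simp add: ext_grade_def)

text \<open>
  Injectivity of \<open>\<sigma>\<close> matters here: otherwise \<open>\<sigma>\<close> could send some \<open>\<alpha>\<^sub>l\<close> with \<open>l \<noteq> k\<close> to \<open>\<alpha>\<^bsub>\<sigma> k\<^esub>\<close>, which \<open>i\<^bsub>\<sigma> k\<^esub>\<close>
  does not kill.
\<close>

lemma ext_perm_contract:
  assumes "inj \<sigma>"
  shows "ext_perm \<sigma> (contract k u) = contract (\<sigma> k) (ext_perm \<sigma> u)"
proof -
  have "(\<lambda>u. ext_perm \<sigma> (contract k u)) = (\<lambda>u. contract (\<sigma> k) (ext_perm \<sigma> u))"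
    by (rule linear_eq_ext_generators[OF
          linear_compose[OF linear_contract ext_perm_linear, unfolded o_def]
          linear_compose[OF ext_perm_linear linear_contract, unfolded o_def]])
       (auto simp: contract_one ext_perm_one linear_0[OF ext_perm_linear] contract_wedge_gen
         ext_perm_wedge ext_perm_gen linear_diff[OF ext_perm_linear] inj_eq[OF assms]
         linear_neg[OF ext_perm_linear])
  then show ?thesis by metis
qed

lemma lefschetz_op_equivariant:
  assumes "bij \<sigma>"
  shows "lefschetz_op (tensor_square_action ext_perm \<sigma> x) =
    tensor_square_action ext_perm \<sigma> (lefschetz_op x)"
proof -
  note lin = tensor_map_linear[OF ext_perm_linear ext_perm_linear, of \<sigma> \<sigma>]
  note act = tensor_map_tensor[OF ext_perm_linear ext_perm_linear, of \<sigma> \<sigma>]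
  have "(\<lambda>x. lefschetz_op ((ext_perm \<sigma> \<otimes>\<^sub>M ext_perm \<sigma>) x)) =
        (\<lambda>x. (ext_perm \<sigma> \<otimes>\<^sub>M ext_perm \<sigma>) (lefschetz_op x))"
  proof (rule linear_eq_tensor)
    show "linear (\<lambda>x. lefschetz_op ((ext_perm \<sigma> \<otimes>\<^sub>M ext_perm \<sigma>) x))"
      "linear (\<lambda>x. (ext_perm \<sigma> \<otimes>\<^sub>M ext_perm \<sigma>) (lefschetz_op x))"
      using linear_compose[OF lin linear_lefschetz_op] linear_compose[OF linear_lefschetz_op lin]
      by (simp_all add: o_def)
    fix u w :: "real ^ ('a set)"
    have "lefschetz_op (ext_perm \<sigma> u \<otimes> ext_perm \<sigma> w) =
        (\<Sum>k\<in>UNIV. (ext_gen (\<sigma> k) \<^bold>\<and> ext_perm \<sigma> u) \<otimes> contract (\<sigma> k) (ext_perm \<sigma> w))"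
      unfolding lefschetz_op_tensor by (rule sum.reindex_bij_betw[symmetric, OF assms])
    also have "\<dots> = (\<Sum>k\<in>UNIV. (ext_perm \<sigma> \<otimes>\<^sub>M ext_perm \<sigma>) ((ext_gen k \<^bold>\<and> u) \<otimes> contract k w))"
      using assms by (simp add: act ext_perm_wedge ext_perm_gen ext_perm_contract bij_is_inj)
    finally show "lefschetz_op ((ext_perm \<sigma> \<otimes>\<^sub>M ext_perm \<sigma>) (u \<otimes> w)) =
        (ext_perm \<sigma> \<otimes>\<^sub>M ext_perm \<sigma>) (lefschetz_op (u \<otimes> w))"
      by (simp add: act lefschetz_op_tensor linear_sum[OF lin])
  qed
  then show ?thesis unfolding tensor_square_action_def by metis
qed


section \<open>Strong equivariant log-concavity\<close>

lemma lefschetz_op_inclusion: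
  assumes "i \<in> {1..m div 2}"
  shows "sym_rep_inclusion (tensor_square_action ext_perm) lefschetz_op
    (ext_grade (i - 1) \<otimes>\<^sub>S ext_grade (m - i + 1)) (ext_grade i \<otimes>\<^sub>S ext_grade (m - i))"
proof -
  have "i - 1 < m - i + 1" using assms by auto
  moreover have "Suc (i - 1) = i" using assms by auto
  ultimately show ?thesis
    unfolding sym_rep_inclusion_def
    using lefschetz_op_in_grade[of _ "i - 1" "m - i"]
    by (auto simp: linear_add[OF linear_lefschetz_op] linear_scale[OF linear_lefschetz_op]
        lefschetz_op_inj_on lefschetz_op_equivariant)
qed

theorem corollary13:
  "strongly_equivariantly_log_concave
     (ext_perm :: ('n::{finite,linorder} \<Rightarrow> 'n) \<Rightarrow> real ^ ('n set) \<Rightarrow> real ^ ('n set)) ext_grade \<and>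
   (\<forall>i>CARD('n). (ext_grade i :: (real ^ ('n set)) set) = {0}) \<and>
   (\<forall>m\<le>2 * CARD('n).
      log_concave_chain (ext_perm :: ('n \<Rightarrow> 'n) \<Rightarrow> _) ext_grade m \<and>
      (\<forall>i\<in>{1..m div 2}.
         sym_rep_inclusion (tensor_square_action (ext_perm :: ('n \<Rightarrow> 'n) \<Rightarrow> _)) lefschetz_op
           (ext_grade (i - 1) \<otimes>\<^sub>S ext_grade (m - i + 1))
           (ext_grade i \<otimes>\<^sub>S ext_grade (m - i))))"
proof -
  have "log_concave_chain (ext_perm :: ('n \<Rightarrow> 'n) \<Rightarrow> _) ext_grade m" for m
    unfolding log_concave_chain_def sym_rep_included_def using lefschetz_op_inclusion by blast
  then show ?thesis
    unfolding strongly_equivariantly_log_concave_def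
    using graded_sym_rep_ext_perm ext_grade_eq_0 lefschetz_op_inclusion by blast
qed

end
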